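(* Let $d=1$ and $W(x)=\frac{|x|^3}{3}-|x|$ on $\mathbb{R}$. There is a unique positive number $R$ satisfying $$\sqrt2\,R=\coth(\sqrt2\,R),$$ and the unique minimizer (up to translation) of the interaction energy $E$ over probability measures on $\mathbb{R}$ is the measure with density $$\rho_1(x)=C\cosh(\sqrt2\,x)\,\chi_{|x|\le R},$$ where $C>0$ is the normalizing constant making the total mass equal to $1$.
   Context: For a probability measure $\rho$ on $\mathbb{R}$, the interaction energy is $E[\rho]=\frac12\int_{\mathbb{R}}\int_{\mathbb{R}}W(x-y)\,d\rho(y)\,d\rho(x)$. $\chi$ denotes an indicator function. *)

theory Defs
  imports "HOL-Probability.Probability"
begin

definition coth :: "real \<Rightarrow> real" where
  "coth x = cosh x / sinh x"

text \<open>
  The Lebesgue integral of an extended-real function as positive part minus negative part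
  (\<^const>\<open>e2ennreal\<close> truncates negative values to 0). The Bochner integral is not used for the
  energy because it returns 0 on non-integrable functions, whereas a potential that is bounded
  below but not integrable must give energy \<open>\<infinity>\<close>. The value is meaningful whenever the
  negative part has finite integral.
\<close>

definition ext_integral :: "'a measure \<Rightarrow> ('a \<Rightarrow> ereal) \<Rightarrow> ereal" where
  "ext_integral M f =
     enn2ereal (\<integral>\<^sup>+ x. e2ennreal (f x) \<partial>M) - enn2ereal (\<integral>\<^sup>+ x. e2ennreal (- f x) \<partial>M)"

lemma ext_integral_eq_integral:
  fixes f :: "'a \<Rightarrow> real"
  assumes "integrable M f"
  shows "ext_integral M (\<lambda>x. ereal (f x)) = ereal (\<integral>x. f x \<partial>M)"
proof -
  have fin: "(\<integral>\<^sup>+ x. ennreal (f x) \<partial>M) \<noteq> \<infinity>" "(\<integral>\<^sup>+ x. ennreal (- f x) \<partial>M) \<noteq> \<infinity>"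
    using assms by (auto simp: real_integrable_def)
  have *: "enn2ereal a = ereal (enn2real a)" if "a \<noteq> \<infinity>" for a
    using that by (cases a) (auto simp: enn2ereal_ennreal)
  show ?thesis
    unfolding ext_integral_def
    using real_lebesgue_integral_def[OF assms] *[OF fin(1)] *[OF fin(2)]
    by (simp add: ennreal.abs_eq)
qed

definition prob_measures :: "real measure set" where
  "prob_measures = {\<rho>. prob_space \<rho> \<and> sets \<rho> = sets borel}"

definition interaction_energy :: "(real \<Rightarrow> real) \<Rightarrow> real measure \<Rightarrow> ereal" where
  "interaction_energy W \<rho> =
     ereal (1 / 2) * ext_integral \<rho> (\<lambda>x. ext_integral \<rho> (\<lambda>y. ereal (W (x - y))))"

definition is_energy_minimizer :: "(real \<Rightarrow> real) \<Rightarrow> real measure \<Rightarrow> bool" where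
  "is_energy_minimizer W \<rho> \<longleftrightarrow>
     \<rho> \<in> prob_measures \<and> (\<forall>\<nu>\<in>prob_measures. interaction_energy W \<rho> \<le> interaction_energy W \<nu>)"

definition translate :: "real \<Rightarrow> real measure \<Rightarrow> real measure" where
  "translate a \<rho> = distr \<rho> borel (\<lambda>x. x + a)"

definition W :: "real \<Rightarrow> real" where
  "W x = \<bar>x\<bar> ^ 3 / 3 - \<bar>x\<bar>"

definition rho1 :: "real \<Rightarrow> real \<Rightarrow> real \<Rightarrow> real" where
  "rho1 C R x = C * cosh (sqrt 2 * x) * indicator {x. \<bar>x\<bar> \<le> R} x"

definition rho1_measure :: "real \<Rightarrow> real \<Rightarrow> real measure" where
  "rho1_measure C R = density lborel (\<lambda>x. ennreal (rho1 C R x))"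

end

theory Submission
  imports Defs
begin

text \<open>
  On measures with mean zero and finite third moment, \<open>W (x - y)\<close> may be replaced by a sum of Gram
  kernels \<open>\<integral>f t x * f t y dt\<close>: ramps account for the cubic part and steps for \<open>- \<bar>x - y\<bar>\<close>, while the
  remaining terms split and cancel in the energy of a difference. So the energy of \<open>\<nu> - \<rho>\<close> is an integral
  of squares, which vanishes only if the distribution functions agree. The potential of \<open>rho1\<close>
  is constant on its support and no smaller outside; the condition \<open>sqrt 2 * R = coth (sqrt 2 * R)\<close>
  is what cancels its quadratic term. Hence \<open>rho1\<close> is the only centred minimizer. Any measure with
  infinite third moment has infinite energy.
\<close>

section \<open>Integrability of kernels of cubic growth against measures with finite third
  moment\<close>

text \<open>Among probability measures these are exactly the ones of finite energy, see
  \<open>interaction_energy_admissible\<close> and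
  \<open>interaction_energy_not_admissible\<close>.\<close>

definition admissible :: "real measure \<Rightarrow> bool" where
  "admissible \<mu> \<longleftrightarrow> prob_space \<mu> \<and> sets \<mu> = sets borel \<and> integrable \<mu> (\<lambda>x. \<bar>x\<bar> ^ 3)"

text \<open>The bound is a sum rather than a product, so one integration over an admissible measure
  leaves a function with a bound of the same type.\<close>

definition cubic_growth :: "(real \<Rightarrow> real \<Rightarrow> real) \<Rightarrow> bool" where
  "cubic_growth K \<longleftrightarrow> case_prod K \<in> borel_measurable (borel \<Otimes>\<^sub>M borel) \<and>
    (\<exists>c. \<forall>x y. \<bar>K x y\<bar> \<le> c * (1 + \<bar>x\<bar> ^ 3 + \<bar>y\<bar> ^ 3))"

definition pair_energy :: "(real \<Rightarrow> real \<Rightarrow> real) \<Rightarrow> real measure \<Rightarrow> real measure \<Rightarrow> real" where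
  "pair_energy K \<mu> \<nu> = (\<integral>x. \<integral>y. K x y \<partial>\<nu> \<partial>\<mu>)"

text \<open>For symmetric \<open>K\<close> this is the quadratic form of \<open>K\<close> at the
  signed measure \<open>\<mu> - \<nu>\<close>, expanded so that no signed measures occur.\<close>

definition energy_dist :: "(real \<Rightarrow> real \<Rightarrow> real) \<Rightarrow> real measure \<Rightarrow> real measure \<Rightarrow> real" where
  "energy_dist K \<mu> \<nu> = pair_energy K \<mu> \<mu> - 2 * pair_energy K \<mu> \<nu> + pair_energy K \<nu> \<nu>"

lemma admissibleD:
  assumes "admissible \<mu>"
  shows "prob_space \<mu>" "sets \<mu> = sets borel" "space \<mu> = UNIV" "integrable \<mu> (\<lambda>x. \<bar>x\<bar> ^ 3)"
    "measurable \<mu> N = measurable borel N"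
  using assms sets_eq_imp_space_eq[of \<mu> borel] by (auto simp: admissible_def cong: measurable_cong_sets)

lemma cubic_growthI:
  assumes "case_prod K \<in> borel_measurable (borel \<Otimes>\<^sub>M borel)"
    and "\<And>x y. \<bar>K x y\<bar> \<le> c * (1 + \<bar>x\<bar> ^ 3 + \<bar>y\<bar> ^ 3)"
  shows "cubic_growth K"
  using assms unfolding cubic_growth_def by blast

lemma integrable_cubic_growth:
  assumes "admissible \<mu>" "g \<in> borel_measurable borel" "\<And>x. \<bar>g x\<bar> \<le> a + b * \<bar>x\<bar> ^ 3"
  shows "integrable \<mu> g"
proof -
  interpret prob_space \<mu> using admissibleD[OF assms(1)] by simp
  have "integrable \<mu> (\<lambda>x. a + b * \<bar>x\<bar> ^ 3)"
    using admissibleD(4)[OF assms(1)] by auto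
  then show ?thesis
    by (rule Bochner_Integration.integrable_bound)
      (use assms admissibleD(5)[OF assms(1)] in \<open>auto intro!: AE_I2 intro: order_trans[OF _ abs_ge_self]\<close>)
qed

lemma cubic_growth_inner:
  assumes "admissible \<nu>" "cubic_growth K"
  shows "integrable \<nu> (K x)"
proof -
  obtain c where m: "case_prod K \<in> borel_measurable (borel \<Otimes>\<^sub>M borel)"
    and c: "\<And>x y. \<bar>K x y\<bar> \<le> c * (1 + \<bar>x\<bar> ^ 3 + \<bar>y\<bar> ^ 3)"
    using assms(2) unfolding cubic_growth_def by blast
  show ?thesis
    using m
    by (intro integrable_cubic_growth[OF assms(1), of _ "c * (1 + \<bar>x\<bar>^3)" c])
       (auto intro: order_trans[OF c] simp: algebra_simps)
qed

lemma cubic_growth_outer: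
  assumes "admissible \<mu>" "admissible \<nu>" "cubic_growth K"
  shows "integrable \<mu> (\<lambda>x. \<integral>y. K x y \<partial>\<nu>)"
proof -
  interpret \<nu>: prob_space \<nu> using admissibleD[OF assms(2)] by simp
  note [measurable_cong] = admissibleD(2)[OF assms(2)]
  obtain c where m[measurable]: "case_prod K \<in> borel_measurable (borel \<Otimes>\<^sub>M borel)"
    and c: "\<And>x y. \<bar>K x y\<bar> \<le> c * (1 + \<bar>x\<bar> ^ 3 + \<bar>y\<bar> ^ 3)"
    using assms(3) unfolding cubic_growth_def by blast
  define M where "M = (\<integral>y. \<bar>y\<bar>^3 \<partial>\<nu>)"
  have b: "\<bar>\<integral>y. K x y \<partial>\<nu>\<bar> \<le> c * (1 + M) + c * \<bar>x\<bar>^3" for x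
  proof -
    have "\<bar>\<integral>y. K x y \<partial>\<nu>\<bar> \<le> (\<integral>y. \<bar>K x y\<bar> \<partial>\<nu>)"
      by simp
    also have "\<dots> \<le> (\<integral>y. c * (1 + \<bar>x\<bar> ^ 3) + c * \<bar>y\<bar> ^ 3 \<partial>\<nu>)"
      using cubic_growth_inner[OF assms(2,3), of x] admissibleD(4)[OF assms(2)]
      by (intro integral_mono) (auto intro: order_trans[OF c] simp: algebra_simps)
    also have "\<dots> = c * (1 + \<bar>x\<bar> ^ 3) + c * M"
      using admissibleD(4)[OF assms(2)] by (simp add: M_def \<nu>.prob_space)
    finally show ?thesis by (simp add: algebra_simps)
  qed
  show ?thesis
    by (rule integrable_cubic_growth[OF assms(1) _ b]) measurable
qed

lemma cubic_growth_add:
  assumes "cubic_growth K" "cubic_growth L"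
  shows "cubic_growth (\<lambda>x y. K x y + L x y)"
proof -
  obtain c d where m[measurable]: "case_prod K \<in> borel_measurable (borel \<Otimes>\<^sub>M borel)" "case_prod L \<in> borel_measurable (borel \<Otimes>\<^sub>M borel)"
    and c: "\<And>x y. \<bar>K x y\<bar> \<le> c * (1 + \<bar>x\<bar> ^ 3 + \<bar>y\<bar> ^ 3)"
    and d: "\<And>x y. \<bar>L x y\<bar> \<le> d * (1 + \<bar>x\<bar> ^ 3 + \<bar>y\<bar> ^ 3)"
    using assms unfolding cubic_growth_def by blast
  show ?thesis
  proof (rule cubic_growthI[of _ "c + d"])
    show "\<bar>K x y + L x y\<bar> \<le> (c + d) * (1 + \<bar>x\<bar> ^ 3 + \<bar>y\<bar> ^ 3)" for x y
      using c[of x y] d[of x y] abs_triangle_ineq[of "K x y" "L x y"] unfolding distrib_right by linarith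
  qed measurable
qed

lemma cubic_growth_cmult:
  assumes "cubic_growth K"
  shows "cubic_growth (\<lambda>x y. a * K x y)"
proof -
  obtain c where m[measurable]: "case_prod K \<in> borel_measurable (borel \<Otimes>\<^sub>M borel)"
    and c: "\<And>x y. \<bar>K x y\<bar> \<le> c * (1 + \<bar>x\<bar> ^ 3 + \<bar>y\<bar> ^ 3)"
    using assms unfolding cubic_growth_def by blast
  show ?thesis
  proof (rule cubic_growthI[of _ "\<bar>a\<bar> * c"])
    show "\<bar>a * K x y\<bar> \<le> (\<bar>a\<bar> * c) * (1 + \<bar>x\<bar> ^ 3 + \<bar>y\<bar> ^ 3)" for x y
      using mult_left_mono[OF c[of x y], of "\<bar>a\<bar>"] by (simp add: abs_mult mult.assoc)
  qed measurable
qed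

lemma energy_dist_add:
  assumes "admissible \<mu>" "admissible \<nu>" "cubic_growth K" "cubic_growth L"
  shows "energy_dist (\<lambda>x y. K x y + L x y) \<mu> \<nu> = energy_dist K \<mu> \<nu> + energy_dist L \<mu> \<nu>"
  by (simp add: energy_dist_def pair_energy_def cubic_growth_inner cubic_growth_outer assms)

lemma energy_dist_cmult:
  "energy_dist (\<lambda>x y. a * K x y) \<mu> \<nu> = a * energy_dist K \<mu> \<nu>"
  by (simp add: energy_dist_def pair_energy_def algebra_simps)

section \<open>Gram kernels as integrals of squares\<close>

text \<open>Tonelli: a Gram kernel turns the double integral into an inner product of mean features.\<close>

lemma pair_energy_gram:
  fixes f :: "real \<Rightarrow> real \<Rightarrow> real"
  assumes \<mu>: "admissible \<mu>" and \<nu>: "admissible \<nu>" and K: "cubic_growth K"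
    and f [measurable]: "case_prod f \<in> borel_measurable (borel \<Otimes>\<^sub>M borel)"
    and f0: "\<And>t x. 0 \<le> f t x"
    and fi: "\<And>t. integrable \<mu> (f t)" "\<And>t. integrable \<nu> (f t)"
    and gram: "\<And>x y. (\<integral>\<^sup>+t. ennreal (f t x * f t y) \<partial>lborel) = ennreal (K x y)"
    and K0: "\<And>x y. 0 \<le> K x y"
  shows "has_bochner_integral lborel (\<lambda>t. (\<integral>x. f t x \<partial>\<mu>) * (\<integral>y. f t y \<partial>\<nu>)) (pair_energy K \<mu> \<nu>)"
proof -
  interpret \<mu>: prob_space \<mu> using admissibleD[OF \<mu>] by simp
  interpret \<nu>: prob_space \<nu> using admissibleD[OF \<nu>] by simp
  interpret L\<nu>: pair_sigma_finite lborel \<nu> ..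
  interpret L\<mu>: pair_sigma_finite lborel \<mu> ..
  note [measurable_cong] = admissibleD(2)[OF \<nu>] admissibleD(2)[OF \<mu>]
  have [measurable]: "case_prod K \<in> borel_measurable (borel \<Otimes>\<^sub>M borel)"
    using K by (simp add: cubic_growth_def)
  have "ennreal (pair_energy K \<mu> \<nu>) = (\<integral>\<^sup>+x. ennreal (\<integral>y. K x y \<partial>\<nu>) \<partial>\<mu>)"
    unfolding pair_energy_def
    by (rule nn_integral_eq_integral[symmetric])
       (auto intro: cubic_growth_outer[OF \<mu> \<nu> K] integral_nonneg_AE simp: K0)
  also have "\<dots> = (\<integral>\<^sup>+x. \<integral>\<^sup>+y. ennreal (K x y) \<partial>\<nu> \<partial>\<mu>)"
    by (intro nn_integral_cong nn_integral_eq_integral[symmetric] cubic_growth_inner[OF \<nu> K])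
       (simp add: K0)
  also have "\<dots> = (\<integral>\<^sup>+x. \<integral>\<^sup>+y. \<integral>\<^sup>+t. ennreal (f t x) * ennreal (f t y) \<partial>lborel \<partial>\<nu> \<partial>\<mu>)"
    by (simp add: gram[symmetric] ennreal_mult f0)
  also have "\<dots> = (\<integral>\<^sup>+x. \<integral>\<^sup>+t. \<integral>\<^sup>+y. ennreal (f t x) * ennreal (f t y) \<partial>\<nu> \<partial>lborel \<partial>\<mu>)"
    by (intro nn_integral_cong L\<nu>.Fubini') measurable
  also have "\<dots> = (\<integral>\<^sup>+x. \<integral>\<^sup>+t. ennreal (f t x) * ennreal (\<integral>y. f t y \<partial>\<nu>) \<partial>lborel \<partial>\<mu>)"
    by (simp add: nn_integral_cmult nn_integral_eq_integral[OF fi(2)] f0)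
  also have "\<dots> = (\<integral>\<^sup>+t. \<integral>\<^sup>+x. ennreal (f t x) * ennreal (\<integral>y. f t y \<partial>\<nu>) \<partial>\<mu> \<partial>lborel)"
    by (intro L\<mu>.Fubini') measurable
  also have "\<dots> = (\<integral>\<^sup>+t. ennreal ((\<integral>x. f t x \<partial>\<mu>) * (\<integral>y. f t y \<partial>\<nu>)) \<partial>lborel)"
    by (simp add: nn_integral_multc nn_integral_eq_integral[OF fi(1)] f0 ennreal_mult integral_nonneg_AE)
  finally have eq: "(\<integral>\<^sup>+t. ennreal ((\<integral>x. f t x \<partial>\<mu>) * (\<integral>y. f t y \<partial>\<nu>)) \<partial>lborel) = ennreal (pair_energy K \<mu> \<nu>)" ..
  have "0 \<le> pair_energy K \<mu> \<nu>"
    unfolding pair_energy_def by (intro integral_nonneg_AE AE_I2 K0)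
  with eq show ?thesis
    by (intro has_bochner_integral_nn_integral) (auto simp: f0 integral_nonneg_AE)
qed

text \<open>By \<open>pair_energy_gram\<close> the three pair energies are integrals of products of
  mean features, which combine into a perfect square for each \<open>t\<close>. This yields both the
  sign and the equality case.\<close>

lemma energy_dist_gram:
  fixes f :: "real \<Rightarrow> real \<Rightarrow> real"
  assumes "admissible \<mu>" and "admissible \<nu>" and "cubic_growth K"
    and "case_prod f \<in> borel_measurable (borel \<Otimes>\<^sub>M borel)"
    and "\<And>t x. 0 \<le> f t x"
    and "\<And>t. integrable \<mu> (f t)" "\<And>t. integrable \<nu> (f t)"
    and "\<And>x y. (\<integral>\<^sup>+t. ennreal (f t x * f t y) \<partial>lborel) = ennreal (K x y)"
    and "\<And>x y. 0 \<le> K x y"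
  shows "has_bochner_integral lborel (\<lambda>t. ((\<integral>x. f t x \<partial>\<mu>) - (\<integral>x. f t x \<partial>\<nu>))\<^sup>2) (energy_dist K \<mu> \<nu>)"
proof -
  let ?a = "\<lambda>t. \<integral>x. f t x \<partial>\<mu>" and ?b = "\<lambda>t. \<integral>x. f t x \<partial>\<nu>"
  have "has_bochner_integral lborel (\<lambda>t. (?a t * ?a t - 2 * (?a t * ?b t)) + ?b t * ?b t) (energy_dist K \<mu> \<nu>)"
    unfolding energy_dist_def
    by (intro has_bochner_integral_add has_bochner_integral_diff has_bochner_integral_mult_right pair_energy_gram assms)
  moreover have "(?a t * ?a t - 2 * (?a t * ?b t)) + ?b t * ?b t = (?a t - ?b t)\<^sup>2" for t
    by (simp add: power2_eq_square algebra_simps)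
  ultimately show ?thesis by simp
qed

section \<open>Ramp and step features with their kernels\<close>

text \<open>Closed form of the integral of \<open>(x - t) * (y - t)\<close> over \<open>t\<close>
  from \<open>0\<close> to \<open>min x y\<close>, and zero if \<open>min x y\<close> is negative:
  the covariance of integrated Brownian motion on the half-line.\<close>

definition ramp_kernel :: "real \<Rightarrow> real \<Rightarrow> real" where
  "ramp_kernel x y = (max 0 (min x y))\<^sup>2 * max x y / 2 - (max 0 (min x y)) ^ 3 / 6"

text \<open>The covariance of two-sided Brownian motion: its double equals
  \<open>\<bar>x\<bar> + \<bar>y\<bar> - \<bar>x - y\<bar>\<close>.\<close>

definition step_kernel :: "real \<Rightarrow> real \<Rightarrow> real" where
  "step_kernel x y = max 0 (min x y) + max 0 (min (- x) (- y))"

text \<open>Cutting off at \<open>0 \<le> t\<close> keeps the integral over \<open>t\<close> finite.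
  Negative points are covered by the same features composed with
  \<open>x \<mapsto> - x\<close>.\<close>

definition ramp :: "real \<Rightarrow> real \<Rightarrow> real" where
  "ramp t x = indicator {0..} t * max 0 (x - t)"

text \<open>Changing from right tails to left tails at \<open>t = 0\<close> confines
  \<open>t\<close> to the interval between \<open>0\<close> and \<open>x\<close>, so that each
  feature is square integrable in \<open>t\<close>.\<close>

definition step :: "real \<Rightarrow> real \<Rightarrow> real" where
  "step t x = (if 0 \<le> t then indicator {t<..} x else indicator {..t} x)"

lemma le_one_plus_cube: "0 \<le> x \<Longrightarrow> x \<le> 1 + x ^ 3" for x :: real
  using power_increasing[of 1 3 x] by (cases "x \<le> 1") (auto intro: order_trans)

lemma square_le_one_plus_cube: "0 \<le> x \<Longrightarrow> x\<^sup>2 \<le> 1 + x ^ 3" for x :: real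
proof -
  assume x: "0 \<le> x"
  have "x\<^sup>2 \<le> 1 \<or> x\<^sup>2 \<le> x ^ 3"
    using x power_increasing[of 2 3 x] power_le_one[of x 2] by force
  then show ?thesis using zero_le_power[OF x, of 3] by linarith
qed

lemma ramp_kernel_nonneg: "0 \<le> ramp_kernel x y"
proof -
  have "(max 0 (min x y)) ^ 3 / 6 \<le> (max 0 (min x y))\<^sup>2 * max x y / 2" 
  proof (cases "0 < min x y")
    case True
    have "(min x y)\<^sup>2 * min x y \<le> (min x y)\<^sup>2 * (max x y * 3)"
      using True by (intro mult_left_mono) auto
    then show ?thesis using True by (simp add: power3_eq_cube power2_eq_square max_def)
  qed (auto simp: max_def)
  then show ?thesis by (simp add: ramp_kernel_def)
qed

lemma ramp_kernel_le: "ramp_kernel x y \<le> \<bar>x\<bar> ^ 3 + \<bar>y\<bar> ^ 3"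
proof (cases "0 < min x y")
  case True
  have "(min x y)\<^sup>2 * max x y \<le> (max x y)\<^sup>2 * max x y"
    using True by (intro mult_right_mono power_mono) auto
  also have "\<dots> \<le> \<bar>x\<bar> ^ 3 + \<bar>y\<bar> ^ 3"
    using True by (auto simp: max_def min_def power3_eq_cube power2_eq_square split: if_splits)
  finally have "(min x y)\<^sup>2 * max x y \<le> \<bar>x\<bar> ^ 3 + \<bar>y\<bar> ^ 3" .
  moreover have "0 \<le> (min x y) ^ 3" "0 \<le> (min x y)\<^sup>2 * max x y"
    using True by (auto simp: max_def)
  ultimately show ?thesis using True
    unfolding ramp_kernel_def max_absorb2[OF less_imp_le[OF True]] by linarith
next
  case False
  then have "max 0 (min x y) = 0" by (intro max_absorb1) linarith
  then show ?thesis by (simp add: ramp_kernel_def)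
qed

lemma cubic_growth_ramp_kernel:
  "cubic_growth ramp_kernel" "cubic_growth (\<lambda>x y. ramp_kernel (- x) (- y))"
proof -
  have [measurable]: "case_prod ramp_kernel \<in> borel_measurable (borel \<Otimes>\<^sub>M borel)"
    unfolding ramp_kernel_def by measurable
  have b: "\<bar>ramp_kernel x y\<bar> \<le> 1 * (1 + \<bar>x\<bar> ^ 3 + \<bar>y\<bar> ^ 3)" for x y
    using ramp_kernel_nonneg[of x y] ramp_kernel_le[of x y] by simp
  show "cubic_growth ramp_kernel"
    by (rule cubic_growthI[OF _ b]) measurable
  show "cubic_growth (\<lambda>x y. ramp_kernel (- x) (- y))"
    by (rule cubic_growthI[of _ 1]) (measurable, use b[of "- x" "- y" for x y] in simp)
qed

lemma cubic_growth_step_kernel: "cubic_growth step_kernel"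
proof (rule cubic_growthI[of _ 1])
  show "case_prod step_kernel \<in> borel_measurable (borel \<Otimes>\<^sub>M borel)"
    unfolding step_kernel_def by measurable
  show "\<bar>step_kernel x y\<bar> \<le> 1 * (1 + \<bar>x\<bar> ^ 3 + \<bar>y\<bar> ^ 3)" for x y
  proof -
    have "\<bar>step_kernel x y\<bar> \<le> \<bar>x\<bar>" by (auto simp: step_kernel_def)
    then show ?thesis
      using le_one_plus_cube[of "\<bar>x\<bar>"] zero_le_power[OF abs_ge_zero[of y], of 3]
      unfolding mult_1 by linarith
  qed
qed

lemma nn_integral_ramp: "(\<integral>\<^sup>+t. ennreal (ramp t x * ramp t y) \<partial>lborel) = ennreal (ramp_kernel x y)"
proof (cases "0 < min x y")
  case True
  define F where "F t = (x * y * t - (x + y) * t\<^sup>2 / 2 + t ^ 3 / 3 :: real)" for t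
  have "(\<integral>\<^sup>+t. ennreal (ramp t x * ramp t y) \<partial>lborel)
      = (\<integral>\<^sup>+t. ennreal ((x - t) * (y - t)) * indicator {0..min x y} t \<partial>lborel)"
    by (intro nn_integral_cong) (auto simp: ramp_def split: split_indicator)
  also have "\<dots> = ennreal (F (min x y) - F 0)"
  proof (rule nn_integral_FTC_Icc)
    show "DERIV F t :> (x - t) * (y - t)" for t
      unfolding F_def by (auto intro!: derivative_eq_intros simp: algebra_simps power2_eq_square)
  qed (use True in auto)
  also have "F (min x y) - F 0 = ramp_kernel x y"
    using True by (cases "x \<le> y")
      (simp_all add: F_def ramp_kernel_def max_def min_def field_simps power2_eq_square power3_eq_cube)
  finally show ?thesis .
next
  case False
  then have z: "ramp t x * ramp t y = 0" for t
    by (auto simp: ramp_def split: split_indicator)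
  have m: "max 0 (min x y) = 0" using False by (intro max_absorb1) linarith
  show ?thesis unfolding z by (simp add: ramp_kernel_def m)
qed

lemma nn_integral_step: "(\<integral>\<^sup>+t. ennreal (step t x * step t y) \<partial>lborel) = ennreal (step_kernel x y)"
proof -
  \<comment> \<open>The product is the indicator of the overlap of the two intervals reaching from
    \<open>0\<close> to \<open>x\<close> and from \<open>0\<close> to \<open>y\<close>. At most one
    of the two intervals on the right is nonempty.\<close>
  have "(\<integral>\<^sup>+t. ennreal (step t x * step t y) \<partial>lborel)
      = (\<integral>\<^sup>+t. indicator {0..<max 0 (min x y)} t + indicator {- max 0 (min (- x) (- y))..<0} t \<partial>lborel)"
    by (intro nn_integral_cong) (auto simp: step_def split: split_indicator)
  also have "\<dots> = ennreal (step_kernel x y)"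
    by (subst nn_integral_add) (auto simp: step_kernel_def)
  finally show ?thesis .
qed

lemma ramp_measurable [measurable]: "case_prod ramp \<in> borel_measurable (borel \<Otimes>\<^sub>M borel)"
  unfolding ramp_def by measurable

lemma step_measurable [measurable]: "case_prod step \<in> borel_measurable (borel \<Otimes>\<^sub>M borel)"
proof -
  have "case_prod step = (\<lambda>(t, x). if 0 \<le> t then (if t < x then 1 else 0) else (if x \<le> t then 1 else 0))"
    by (auto simp: step_def fun_eq_iff)
  then show ?thesis by simp
qed

lemma integrable_ramp:
  assumes "admissible \<mu>"
  shows "integrable \<mu> (ramp t)" "integrable \<mu> (\<lambda>x. ramp t (- x))"
proof -
  have b: "\<bar>ramp t x\<bar> \<le> 1 + 1 * \<bar>x\<bar> ^ 3" for x
  proof -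
    have "\<bar>ramp t x\<bar> \<le> \<bar>x\<bar>" by (auto simp: ramp_def split: split_indicator)
    then show ?thesis using le_one_plus_cube[of "\<bar>x\<bar>"] by simp
  qed
  show "integrable \<mu> (ramp t)"
    by (rule integrable_cubic_growth[OF assms _ b]) measurable
  show "integrable \<mu> (\<lambda>x. ramp t (- x))"
    by (rule integrable_cubic_growth[OF assms, of _ 1 1]) (measurable, use b[of "- x" for x] in simp)
qed

lemma integrable_step:
  assumes "admissible \<mu>"
  shows "integrable \<mu> (step t)"
  by (rule integrable_cubic_growth[OF assms, of _ 1 0]) (measurable, auto simp: step_def split: split_indicator)

lemma energy_dist_ramp_nonneg:
  assumes "admissible \<mu>" "admissible \<nu>"
  shows "0 \<le> energy_dist ramp_kernel \<mu> \<nu>" "0 \<le> energy_dist (\<lambda>x y. ramp_kernel (- x) (- y)) \<mu> \<nu>"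
proof -
  have "has_bochner_integral lborel (\<lambda>t. ((\<integral>x. ramp t x \<partial>\<mu>) - (\<integral>x. ramp t x \<partial>\<nu>))\<^sup>2) (energy_dist ramp_kernel \<mu> \<nu>)"
    by (rule energy_dist_gram[OF assms cubic_growth_ramp_kernel(1)])
       (auto simp: integrable_ramp assms nn_integral_ramp ramp_kernel_nonneg, simp add: ramp_def)
  then show "0 \<le> energy_dist ramp_kernel \<mu> \<nu>"
    by (auto dest!: has_bochner_integral_integral_eq[symmetric])
  have "has_bochner_integral lborel (\<lambda>t. ((\<integral>x. ramp t (- x) \<partial>\<mu>) - (\<integral>x. ramp t (- x) \<partial>\<nu>))\<^sup>2)
     (energy_dist (\<lambda>x y. ramp_kernel (- x) (- y)) \<mu> \<nu>)"
    by (rule energy_dist_gram[OF assms cubic_growth_ramp_kernel(2)])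
       (measurable, auto simp: integrable_ramp assms nn_integral_ramp ramp_kernel_nonneg, simp add: ramp_def)
  then show "0 \<le> energy_dist (\<lambda>x y. ramp_kernel (- x) (- y)) \<mu> \<nu>"
    by (auto dest!: has_bochner_integral_integral_eq[symmetric])
qed

lemma energy_dist_step:
  assumes "admissible \<mu>" "admissible \<nu>"
  shows "has_bochner_integral lborel (\<lambda>t. ((\<integral>x. step t x \<partial>\<mu>) - (\<integral>x. step t x \<partial>\<nu>))\<^sup>2) (energy_dist step_kernel \<mu> \<nu>)"
  by (rule energy_dist_gram[OF assms cubic_growth_step_kernel])
     (auto simp: integrable_step assms nn_integral_step step_kernel_def, simp add: step_def)

lemma energy_dist_step_nonneg:
  assumes "admissible \<mu>" "admissible \<nu>"
  shows "0 \<le> energy_dist step_kernel \<mu> \<nu>"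
  using energy_dist_step[OF assms] by (auto dest!: has_bochner_integral_integral_eq[symmetric])

section \<open>Recovering a measure from its step features\<close>

text \<open>By right continuity, distribution functions that differ at a point differ on a whole
  interval to its right, and such an interval is not a null set.\<close>

lemma cdf_eq_AE_imp_eq:
  assumes \<mu>: "real_distribution \<mu>" and \<nu>: "real_distribution \<nu>"
    and ae: "AE t in lborel. cdf \<mu> t = cdf \<nu> t"
  shows "\<mu> = \<nu>"
proof (rule cdf_unique[OF \<mu> \<nu>], rule ext, rule ccontr)
  fix a assume neq: "cdf \<mu> a \<noteq> cdf \<nu> a"
  interpret \<mu>: real_distribution \<mu> by fact
  interpret \<nu>: real_distribution \<nu> by fact
  have "((\<lambda>t. cdf \<mu> t - cdf \<nu> t) \<longlongrightarrow> cdf \<mu> a - cdf \<nu> a) (at_right a)"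
    using \<mu>.cdf_is_right_cont[of a] \<nu>.cdf_is_right_cont[of a]
    by (auto simp: continuous_within intro: tendsto_diff)
  then have "eventually (\<lambda>t. cdf \<mu> t - cdf \<nu> t \<noteq> 0) (at_right a)"
    by (rule tendsto_imp_eventually_ne) (use neq in simp)
  then obtain b where b: "a < b" "\<And>t. a < t \<Longrightarrow> t < b \<Longrightarrow> cdf \<mu> t \<noteq> cdf \<nu> t"
    by (auto simp: eventually_at_right_field)
  from ae have "AE t in lborel. t \<notin> {a<..<b}"
    by eventually_elim (use b in auto)
  then have "emeasure lborel {a<..<b} = 0"
    by (subst (asm) AE_iff_measurable[of "{a<..<b}"]) auto
  then show False using b by simp
qed

lemma admissible_real_distribution: "admissible \<mu> \<Longrightarrow> real_distribution \<mu>"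
  by (auto simp: admissible_def real_distribution_def real_distribution_axioms_def)

text \<open>This is the source of uniqueness: the integrand for the step kernel is the squared
  difference of the distribution functions.\<close>

lemma energy_dist_step_eq_0:
  assumes \<mu>: "admissible \<mu>" and \<nu>: "admissible \<nu>" and "energy_dist step_kernel \<mu> \<nu> \<le> 0"
  shows "\<mu> = \<nu>"
proof (rule cdf_eq_AE_imp_eq[OF \<mu>[THEN admissible_real_distribution] \<nu>[THEN admissible_real_distribution]])
  have step_cdf: "(\<integral>x. step t x \<partial>\<rho>) = (if 0 \<le> t then 1 - cdf \<rho> t else cdf \<rho> t)" if "admissible \<rho>" for \<rho> t
  proof -
    interpret real_distribution \<rho> using admissible_real_distribution[OF that] .
    have "{t<..} = UNIV - {..t}" by auto
    then have "measure \<rho> {t<..} = 1 - cdf \<rho> t"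
      using prob_compl[of "{..t}"] by (simp add: cdf_def)
    then show ?thesis by (auto simp: step_def[abs_def] cdf_def)
  qed
  have "energy_dist step_kernel \<mu> \<nu> = 0"
    using assms(3) energy_dist_step_nonneg[OF \<mu> \<nu>] by simp
  with energy_dist_step[OF \<mu> \<nu>]
  have "AE t in lborel. ((\<integral>x. step t x \<partial>\<mu>) - (\<integral>x. step t x \<partial>\<nu>))\<^sup>2 = 0"
    by (subst integral_nonneg_eq_0_iff_AE[symmetric])
       (auto dest: has_bochner_integral_integral_eq simp: has_bochner_integral_iff)
  then show "AE t in lborel. cdf \<mu> t = cdf \<nu> t"
    by eventually_elim (auto simp: step_cdf[OF \<mu>] step_cdf[OF \<nu>] split: if_splits)
qed

section \<open>Decomposition of \<open>W\<close> on centred measures\<close>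

definition centered :: "real measure \<Rightarrow> bool" where
  "centered \<mu> \<longleftrightarrow> admissible \<mu> \<and> (\<integral>x. x \<partial>\<mu>) = 0"

text \<open>Each term depends on one variable only or is a product such as
  \<open>(x * \<bar>x\<bar>) * y\<close>, with a factor that integrates to zero against a centred
  measure.\<close>

definition moment_kernel :: "real \<Rightarrow> real \<Rightarrow> real" where
  "moment_kernel x y = (\<bar>x\<bar> ^ 3 + \<bar>y\<bar> ^ 3) / 3 - x * y * (\<bar>x\<bar> + \<bar>y\<bar>) - \<bar>x\<bar> - \<bar>y\<bar>"

text \<open>For opposite signs the ramp and step kernels vanish and \<open>moment_kernel\<close> is
  all of \<open>W (x - y)\<close>. For equal signs the ramps correct the cubic part and the steps
  the linear part.\<close>

lemma W_decomp:
  "W (x - y) = 4 * ramp_kernel x y + (4 * ramp_kernel (- x) (- y) + (2 * step_kernel x y + moment_kernel x y))"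
proof -
  consider "0 < x" "x \<le> y" | "0 < y" "y \<le> x" | "x < 0" "0 < y" | "y < 0" "0 < x"
    | "x \<le> y" "y < 0" | "y \<le> x" "x < 0" | "x = 0" | "y = 0" by linarith
  then show ?thesis
    by (cases; simp add: W_def ramp_kernel_def step_kernel_def moment_kernel_def abs_if max_def min_def)
       (auto simp: power3_eq_cube power2_eq_square field_simps)
qed

lemma integrable_moments:
  assumes "admissible \<mu>"
  shows "integrable \<mu> (\<lambda>x. x)" "integrable \<mu> (\<lambda>x. \<bar>x\<bar>)" "integrable \<mu> (\<lambda>x. x * \<bar>x\<bar>)"
proof -
  show "integrable \<mu> (\<lambda>x. x)"
    by (rule integrable_cubic_growth[OF assms, of _ 1 1]) (auto simp: le_one_plus_cube)
  then show "integrable \<mu> (\<lambda>x. \<bar>x\<bar>)" by simp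
  show "integrable \<mu> (\<lambda>x. x * \<bar>x\<bar>)"
    using square_le_one_plus_cube[of "\<bar>x\<bar>" for x]
    by (intro integrable_cubic_growth[OF assms, of _ 1 1]) (auto simp: abs_mult power2_eq_square)
qed

text \<open>The mixed products drop out, leaving a function of \<open>\<mu>\<close> plus the same
  function of \<open>\<nu>\<close>. Such a sum cancels in \<open>energy_dist\<close>.\<close>

lemma pair_energy_moment_kernel:
  assumes "centered \<mu>" "centered \<nu>"
  shows "pair_energy moment_kernel \<mu> \<nu> =
    ((\<integral>x. \<bar>x\<bar> ^ 3 \<partial>\<mu>) + (\<integral>x. \<bar>x\<bar> ^ 3 \<partial>\<nu>)) / 3 - (\<integral>x. \<bar>x\<bar> \<partial>\<mu>) - (\<integral>x. \<bar>x\<bar> \<partial>\<nu>)"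
proof -
  have a: "admissible \<mu>" "admissible \<nu>" and c: "(\<integral>x. x \<partial>\<mu>) = 0" "(\<integral>x. x \<partial>\<nu>) = 0"
    using assms by (auto simp: centered_def)
  interpret \<mu>: prob_space \<mu> using admissibleD[OF a(1)] by simp
  interpret \<nu>: prob_space \<nu> using admissibleD[OF a(2)] by simp
  note [simp] = integrable_moments[OF a(1)] integrable_moments[OF a(2)] admissibleD(4)[OF a(1)] admissibleD(4)[OF a(2)]
    \<mu>.prob_space \<nu>.prob_space c
  have *: "moment_kernel x y = \<bar>x\<bar> ^ 3 / 3 + \<bar>y\<bar> ^ 3 / 3 - (x * \<bar>x\<bar>) * y - x * (y * \<bar>y\<bar>) - \<bar>x\<bar> - \<bar>y\<bar>" for x y
    by (simp add: moment_kernel_def algebra_simps)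
  have "(\<integral>y. moment_kernel x y \<partial>\<nu>) = \<bar>x\<bar> ^ 3 / 3 + (\<integral>y. \<bar>y\<bar> ^ 3 \<partial>\<nu>) / 3 - x * (\<integral>y. y * \<bar>y\<bar> \<partial>\<nu>) - \<bar>x\<bar> - (\<integral>y. \<bar>y\<bar> \<partial>\<nu>)" for x
    unfolding * by simp
  then show ?thesis
    unfolding pair_energy_def by simp
qed

lemma cubic_growth_moment_kernel: "cubic_growth moment_kernel"
proof (rule cubic_growthI[of _ 10])
  show "case_prod moment_kernel \<in> borel_measurable (borel \<Otimes>\<^sub>M borel)"
    unfolding moment_kernel_def by measurable
  show "\<bar>moment_kernel x y\<bar> \<le> 10 * (1 + \<bar>x\<bar> ^ 3 + \<bar>y\<bar> ^ 3)" for x y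
  proof -
    define a b where "a = \<bar>x\<bar>" and "b = \<bar>y\<bar>"
    have ab: "0 \<le> a" "0 \<le> b" by (auto simp: a_def b_def)
    have "a * b * (a + b) \<le> 4 * (a ^ 3 + b ^ 3)"
    proof -
      \<comment> \<open>The product expands to
        \<open>a ^ 3 + b ^ 3 - a * b * (a + b)\<close>.\<close>
      have "0 \<le> (a + b) * (a - b)\<^sup>2" using ab by simp
      moreover have "0 \<le> a ^ 3" "0 \<le> b ^ 3" using ab by auto
      ultimately show ?thesis by (simp add: power3_eq_cube power2_eq_square algebra_simps)
    qed
    moreover have "\<bar>moment_kernel x y\<bar> \<le> (a ^ 3 + b ^ 3) / 3 + a * b * (a + b) + a + b"
    proof -
      have "\<bar>x * y * (a + b)\<bar> = a * b * (a + b)" by (simp add: a_def b_def abs_mult)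
      then have "x * y * (a + b) \<le> a * b * (a + b)" "- (x * y * (a + b)) \<le> a * b * (a + b)"
        by linarith+
      moreover have "0 \<le> a ^ 3" "0 \<le> b ^ 3" using ab by auto
      ultimately show ?thesis using ab
        unfolding moment_kernel_def a_def[symmetric] b_def[symmetric] by (intro abs_leI) argo+
    qed
    moreover have "0 \<le> a ^ 3" "0 \<le> b ^ 3" using ab by auto
    ultimately show ?thesis
      using le_one_plus_cube[OF ab(1)] le_one_plus_cube[OF ab(2)] unfolding a_def[symmetric] b_def[symmetric] by argo
  qed
qed

lemma cubic_growth_W: "cubic_growth (\<lambda>x y. W (x - y))"
  unfolding W_decomp
  by (intro cubic_growth_add cubic_growth_cmult cubic_growth_ramp_kernel cubic_growth_step_kernel cubic_growth_moment_kernel)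

text \<open>The ramp parts are discarded by their sign; the step part is kept because it detects
  equality of the measures.\<close>

lemma energy_dist_W:
  assumes "centered \<mu>" "centered \<nu>"
  shows "energy_dist (\<lambda>x y. W (x - y)) \<mu> \<nu> \<ge> 2 * energy_dist step_kernel \<mu> \<nu>"
proof -
  have a: "admissible \<mu>" "admissible \<nu>" using assms by (auto simp: centered_def)
  have "energy_dist moment_kernel \<mu> \<nu> = 0"
    by (simp add: energy_dist_def pair_energy_moment_kernel assms field_simps)
  then have "energy_dist (\<lambda>x y. W (x - y)) \<mu> \<nu> = 4 * energy_dist ramp_kernel \<mu> \<nu>
      + (4 * energy_dist (\<lambda>x y. ramp_kernel (- x) (- y)) \<mu> \<nu> + 2 * energy_dist step_kernel \<mu> \<nu>)"
    unfolding W_decomp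
    by (simp add: energy_dist_add energy_dist_cmult a cubic_growth_add cubic_growth_cmult
        cubic_growth_ramp_kernel cubic_growth_step_kernel cubic_growth_moment_kernel)
  then show ?thesis using energy_dist_ramp_nonneg[OF a] by simp
qed

section \<open>Integration against \<open>rho1\<close>\<close>

text \<open>The factor \<open>u\<close> smooths the corner at zero, so the antiderivative in
  \<open>potential_rho1\<close> is valid across \<open>y = x\<close> without splitting the
  interval.\<close>

lemma DERIV_mult_abs: "((\<lambda>u. u * \<bar>u\<bar>) has_real_derivative 2 * \<bar>u\<bar>) (at u)"
proof -
  consider "u < 0" | "u = 0" | "0 < u" by linarith
  then show ?thesis
  proof cases
    case 1
    have "((\<lambda>u. - (u * u)) has_real_derivative 2 * \<bar>u\<bar>) (at u)"
      using 1 by (auto intro!: derivative_eq_intros)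
    then show ?thesis
      by (rule has_field_derivative_transform_within_open[where S = "{..<0}"]) (use 1 in auto)
  next
    case 2
    have "((\<lambda>h. \<bar>h\<bar>) \<longlongrightarrow> (0::real)) (at 0)"
      using tendsto_rabs[OF tendsto_ident_at, of "0::real"] by simp
    then have "((\<lambda>h. h * \<bar>h\<bar> / h) \<longlongrightarrow> (0::real)) (at 0)"
      by (rule Lim_transform_eventually) (auto simp: eventually_at_filter)
    then show ?thesis using 2 by (simp add: DERIV_def)
  next
    case 3
    have "((\<lambda>u. u * u) has_real_derivative 2 * \<bar>u\<bar>) (at u)"
      using 3 by (auto intro!: derivative_eq_intros)
    then show ?thesis
      by (rule has_field_derivative_transform_within_open[where S = "{0<..}"]) (use 3 in auto)
  qed
qed

lemma DERIV_abs_cube: "((\<lambda>u. \<bar>u\<bar> ^ 3) has_real_derivative 3 * (u * \<bar>u\<bar>)) (at u)"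
proof -
  have "\<bar>u\<bar> ^ 3 = u * (u * \<bar>u\<bar>)" for u :: real
    by (simp add: power3_eq_cube abs_if)
  moreover have "((\<lambda>u. u * (u * \<bar>u\<bar>)) has_real_derivative 3 * (u * \<bar>u\<bar>)) (at u)"
    using DERIV_mult[OF DERIV_ident DERIV_mult_abs, of u] by (simp add: algebra_simps)
  ultimately show ?thesis by simp
qed

lemma sqrt2_cancel: "sqrt 2 * (sqrt 2 * a) = 2 * a"
  by (simp flip: mult.assoc)

lemma rho1_nonneg: "0 \<le> C \<Longrightarrow> 0 \<le> rho1 C R x"
  by (simp add: rho1_def)

lemma rho1_measurable [measurable]: "rho1 C R \<in> borel_measurable borel"
proof -
  have "(\<lambda>x::real. cosh (sqrt 2 * x)) \<in> borel_measurable borel"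
    by (intro borel_measurable_continuous_onI continuous_intros)
  then show ?thesis unfolding rho1_def[abs_def] by measurable
qed

lemma sets_rho1_measure [measurable_cong]: "sets (rho1_measure C R) = sets borel"
  by (simp add: rho1_measure_def)

lemma integral_rho1_measure:
  assumes "0 \<le> C" "0 \<le> R" "g \<in> borel_measurable borel" "\<And>y. isCont g y"
    and F: "\<And>y. (F has_real_derivative g y * cosh (sqrt 2 * y)) (at y)"
  shows "(\<integral>y. g y \<partial>rho1_measure C R) = C * (F R - F (- R))"
proof -
  have "(\<integral>y. g y \<partial>rho1_measure C R) = (\<integral>y. rho1 C R y *\<^sub>R g y \<partial>lborel)"
    unfolding rho1_measure_def
    using assms by (intro integral_density) (auto simp: rho1_nonneg)
  also have "\<dots> = (\<integral>y. C * ((g y * cosh (sqrt 2 * y)) * indicator {- R..R} y) \<partial>lborel)"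
    by (intro Bochner_Integration.integral_cong) (auto simp: rho1_def split: split_indicator)
  also have "\<dots> = C * (F R - F (- R))"
    using assms by (subst integral_mult_right_zero, subst integral_FTC_Icc_real[OF _ F]) (auto intro!: continuous_intros)
  finally show ?thesis .
qed

lemma emeasure_rho1_measure:
  assumes "0 \<le> C" "0 \<le> R"
  shows "emeasure (rho1_measure C R) UNIV = ennreal (C * sqrt 2 * sinh (sqrt 2 * R))"
proof -
  have "emeasure (rho1_measure C R) UNIV = (\<integral>\<^sup>+y. ennreal (rho1 C R y) \<partial>lborel)"
    by (simp add: rho1_measure_def emeasure_density)
  also have "\<dots> = (\<integral>\<^sup>+y. ennreal (C * cosh (sqrt 2 * y)) * indicator {- R..R} y \<partial>lborel)"
    by (intro nn_integral_cong) (auto simp: rho1_def split: split_indicator)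
  also have "\<dots> = ennreal (C * sinh (sqrt 2 * R) / sqrt 2 - C * sinh (sqrt 2 * - R) / sqrt 2)"
  proof (rule nn_integral_FTC_Icc)
    show "((\<lambda>y. C * sinh (sqrt 2 * y) / sqrt 2) has_real_derivative C * cosh (sqrt 2 * y)) (at y)" for y
      by (auto intro!: derivative_eq_intros)
    show "(\<lambda>y. C * cosh (sqrt 2 * y)) \<in> borel_measurable borel"
      by (intro borel_measurable_continuous_onI continuous_intros)
  qed (use assms in auto)
  also have "C * sinh (sqrt 2 * R) / sqrt 2 - C * sinh (sqrt 2 * - R) / sqrt 2 = C * sqrt 2 * sinh (sqrt 2 * R)"
    by (simp add: field_simps)
  finally show ?thesis .
qed

lemma AE_rho1_measure: "AE x in rho1_measure C R. \<bar>x\<bar> \<le> R"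
proof -
  have "AE x in lborel. 0 < ennreal (rho1 C R x) \<longrightarrow> \<bar>x\<bar> \<le> R"
    by (intro AE_I2) (auto simp: rho1_def split: split_indicator)
  then show ?thesis unfolding rho1_measure_def by (subst AE_density) auto
qed

lemma centered_rho1_measure:
  assumes "0 \<le> C" "0 \<le> R" "emeasure (rho1_measure C R) UNIV = 1"
  shows "centered (rho1_measure C R)"
proof -
  interpret prob_space "rho1_measure C R"
    using assms(3) by (intro prob_spaceI) (simp add: rho1_measure_def)
  have "AE x in rho1_measure C R. norm (\<bar>x\<bar> ^ 3) \<le> R ^ 3"
    using AE_rho1_measure[where C = C and R = R] by eventually_elim (auto intro: power_mono)
  then have "integrable (rho1_measure C R) (\<lambda>x. \<bar>x\<bar> ^ 3)"
    by (rule integrable_const_bound) measurable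
  moreover have "(\<integral>x. x \<partial>rho1_measure C R) = 0"
    \<comment> \<open>The witness comes from integrating \<open>y * cosh (sqrt 2 * y)\<close> by
      parts. It is even, so its values at \<open>R\<close> and \<open>- R\<close> cancel.\<close>
    by (subst integral_rho1_measure[OF assms(1,2), where F = "\<lambda>y. y * sinh (sqrt 2 * y) * (sqrt 2 / 2) - cosh (sqrt 2 * y) / 2"])
       (auto intro!: derivative_eq_intros simp: algebra_simps sqrt2_cancel)
  ultimately show ?thesis
    unfolding centered_def admissible_def by (auto simp: sets_rho1_measure prob_space_axioms)
qed

section \<open>The fixed point of coth\<close>

lemma coth_eq_iff: "0 < x \<Longrightarrow> x = coth x \<longleftrightarrow> x * sinh x = cosh x"
  by (auto simp: coth_def field_simps)

lemma DERIV_mult_sinh_diff_cosh: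
  "((\<lambda>x. x * sinh x - cosh x) has_real_derivative x * cosh x) (at (x :: real))"
  by (auto intro!: derivative_eq_intros)

text \<open>Clearing the denominator turns fixed points into positive zeros of
  \<open>x * sinh x - cosh x\<close>. This function is \<open>- 1\<close> at zero and has derivative
  \<open>x * cosh x\<close>, hence increases strictly on the positive axis.\<close>

lemma ex1_coth_fixpoint: "\<exists>!R. R > 0 \<and> sqrt 2 * R = coth (sqrt 2 * R)"
proof -
  let ?f = "\<lambda>x::real. x * sinh x - cosh x"
  have mono: "?f x < ?f y" if "0 < x" "x < y" for x y
  proof (rule DERIV_pos_imp_increasing[OF that(2)])
    fix u assume "x \<le> u"
    then have "0 < u * cosh u" using that(1) by simp
    then show "\<exists>D. (?f has_real_derivative D) (at u) \<and> 0 < D"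
      using DERIV_mult_sinh_diff_cosh by blast
  qed
  have "\<exists>x\<ge>0. x \<le> 2 \<and> ?f x = 0"
  proof (rule IVT)
    \<comment> \<open>In exponentials, \<open>?f 2\<close> is
      \<open>(exp 2 - 3 * exp (- 2)) / 2\<close>.\<close>
    have "3 * exp (- 2) \<le> (3::real)" by simp
    also have "3 \<le> exp (2::real)" using exp_ge_add_one_self[of "2::real"] by simp
    finally show "0 \<le> ?f 2" by (simp add: sinh_field_def cosh_field_def)
  qed (use DERIV_mult_sinh_diff_cosh[THEN DERIV_isCont] in auto)
  then obtain x where x: "0 \<le> x" "?f x = 0" by blast
  then have "0 < x" by (cases "x = 0") auto
  show ?thesis
  proof (rule ex1I[of _ "x / sqrt 2"])
    show "x / sqrt 2 > 0 \<and> sqrt 2 * (x / sqrt 2) = coth (sqrt 2 * (x / sqrt 2))"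
      using \<open>0 < x\<close> x coth_eq_iff[of x] by simp
    fix R assume R: "R > 0 \<and> sqrt 2 * R = coth (sqrt 2 * R)"
    then have "0 < sqrt 2 * R" by simp
    with R have "?f (sqrt 2 * R) = 0" using coth_eq_iff[of "sqrt 2 * R"] by auto
    then have "sqrt 2 * R = x"
      using mono[of "sqrt 2 * R" x] mono[of x "sqrt 2 * R"] \<open>0 < x\<close> \<open>0 < sqrt 2 * R\<close> x by linarith
    then show "R = x / sqrt 2" by (simp add: field_simps)
  qed
qed

section \<open>The potential of \<open>rho1\<close> and the lower bound on the energy\<close>

text \<open>The antiderivative is exact because \<open>\<bar>u\<bar>\<^sup>3 / 3 - \<bar>u\<bar>\<close> is tuned to the frequency \<open>sqrt 2\<close>:
  the \<open>\<bar>u\<bar>\<close> terms of the repeated integration by parts cancel.\<close>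

lemma potential_rho1:
  assumes "0 \<le> C" "0 < R" "sqrt 2 * R = coth (sqrt 2 * R)"
  shows "(\<integral>y. W (x - y) \<partial>rho1_measure C R) = C * (sinh (sqrt 2 * R) * sqrt 2 / 2) *
    ((\<bar>x - R\<bar> ^ 3 + \<bar>x + R\<bar> ^ 3) / 3 + R * ((x - R) * \<bar>x - R\<bar> - (x + R) * \<bar>x + R\<bar>))"
proof -
  let ?s = "sqrt 2 :: real"
  define F where "F y = \<bar>x - y\<bar> ^ 3 * (sinh (?s * y) * (?s / 6)) + (x - y) * \<bar>x - y\<bar> * (cosh (?s * y) / 2)" for y
  define S where "S = sinh (?s * R)"
  \<comment> \<open>The equation for \<open>R\<close> trades cosh for sinh at the endpoints, so
    every boundary term carries the common factor \<open>S\<close>.\<close>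
  have c: "cosh (?s * R) = ?s * R * sinh (?s * R)"
    using assms coth_eq_iff[of "?s * R"] by simp
  have "(\<integral>y. W (x - y) \<partial>rho1_measure C R) = C * (F R - F (- R))"
  proof (rule integral_rho1_measure)
    show "(F has_real_derivative W (x - y) * cosh (?s * y)) (at y)" for y
    proof -
      have d0: "((\<lambda>y. x - y) has_real_derivative - 1) (at y)"
        by (auto intro!: derivative_eq_intros)
      have d1: "((\<lambda>y. \<bar>x - y\<bar> ^ 3) has_real_derivative - (3 * ((x - y) * \<bar>x - y\<bar>))) (at y)"
        using DERIV_chain2[OF DERIV_abs_cube d0] by simp
      have d2: "((\<lambda>y. (x - y) * \<bar>x - y\<bar>) has_real_derivative - (2 * \<bar>x - y\<bar>)) (at y)"
        using DERIV_chain2[OF DERIV_mult_abs d0] by simp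
      have d3: "((\<lambda>y. sinh (?s * y) * (?s / 6)) has_real_derivative cosh (?s * y) / 3) (at y)"
        by (auto intro!: derivative_eq_intros)
      have d4: "((\<lambda>y. cosh (?s * y) / 2) has_real_derivative sinh (?s * y) * ?s / 2) (at y)"
        by (auto intro!: derivative_eq_intros)
      show ?thesis
        unfolding F_def
        by (rule DERIV_cong[OF DERIV_add[OF DERIV_mult[OF d1 d3] DERIV_mult[OF d2 d4]]])
           (simp add: W_def algebra_simps diff_divide_distrib)
    qed
  qed (use assms in \<open>auto simp: W_def intro!: continuous_intros\<close>)
  also have "F R = \<bar>x - R\<bar> ^ 3 * (S * (?s / 6)) + (x - R) * \<bar>x - R\<bar> * (?s * R * S / 2)"
    by (simp only: F_def c S_def)
  also have "F (- R) = - (\<bar>x + R\<bar> ^ 3 * (S * (?s / 6))) + (x + R) * \<bar>x + R\<bar> * (?s * R * S / 2)"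
    by (simp add: F_def c S_def)
  finally show ?thesis
    unfolding S_def[symmetric] by (simp add: field_simps)
qed

text \<open>On the support the terms \<open>2 * R * x\<^sup>2\<close> from the cubes and from the
  squares cancel. Outside, the excess over the constant factors as \<open>2 * (\<bar>x\<bar> -
  R)\<^sup>2 * (\<bar>x\<bar> + 2 * R) / 3\<close>.\<close>

lemma potential_polynomial:
  fixes x R :: real
  assumes "0 < R"
  defines "P \<equiv> (\<bar>x - R\<bar> ^ 3 + \<bar>x + R\<bar> ^ 3) / 3 + R * ((x - R) * \<bar>x - R\<bar> - (x + R) * \<bar>x + R\<bar>)"
  shows "\<bar>x\<bar> \<le> R \<Longrightarrow> P = - 4 * R ^ 3 / 3" and "P \<ge> - 4 * R ^ 3 / 3"
proof -
  show eq: "P = - 4 * R ^ 3 / 3" if "\<bar>x\<bar> \<le> R"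
  proof -
    have "\<bar>x - R\<bar> = R - x" "\<bar>x + R\<bar> = x + R" using that by auto
    then show ?thesis unfolding P_def by (simp only:) (simp add: power3_eq_cube field_simps)
  qed
  have pos: "0 \<le> 2 * (\<bar>x\<bar> - R)\<^sup>2 * (\<bar>x\<bar> + 2 * R) / 3"
    using assms(1) by simp
  consider "\<bar>x\<bar> \<le> R" | "R < x" | "x < - R" by linarith
  then show "P \<ge> - 4 * R ^ 3 / 3"
  proof cases
    case 2
    then have a: "\<bar>x - R\<bar> = x - R" "\<bar>x + R\<bar> = x + R" "\<bar>x\<bar> = x" using assms(1) by auto
    have "P = - 4 * R ^ 3 / 3 + 2 * (\<bar>x\<bar> - R)\<^sup>2 * (\<bar>x\<bar> + 2 * R) / 3"
      unfolding P_def a by (simp add: power3_eq_cube power2_eq_square field_simps)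
    with pos show ?thesis by linarith
  next
    case 3
    then have a: "\<bar>x - R\<bar> = R - x" "\<bar>x + R\<bar> = - x - R" "\<bar>x\<bar> = - x" using assms(1) by auto
    have "P = - 4 * R ^ 3 / 3 + 2 * (\<bar>x\<bar> - R)\<^sup>2 * (\<bar>x\<bar> + 2 * R) / 3"
      unfolding P_def a by (simp add: power3_eq_cube power2_eq_square field_simps)
    with pos show ?thesis by linarith
  qed (use eq in simp)
qed

text \<open>Euler--Lagrange: the potential of \<open>rho1_measure C R\<close> attains its minimum on the whole support,
  so the linear term of the expansion around it is nonnegative.\<close>

lemma pair_energy_W_ge:
  assumes C: "0 < C" and R: "0 < R" "sqrt 2 * R = coth (sqrt 2 * R)"
    and 1: "emeasure (rho1_measure C R) UNIV = 1" and \<nu>: "centered \<nu>"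
  defines "\<rho> \<equiv> rho1_measure C R"
  shows "pair_energy (\<lambda>x y. W (x - y)) \<nu> \<nu> \<ge> pair_energy (\<lambda>x y. W (x - y)) \<rho> \<rho> + 2 * energy_dist step_kernel \<nu> \<rho>"
proof -
  have \<rho>: "centered \<rho>" using centered_rho1_measure[OF _ _ 1] C R(1) by (simp add: \<rho>_def)
  have a: "admissible \<nu>" "admissible \<rho>" using \<nu> \<rho> by (auto simp: centered_def)
  interpret \<nu>: prob_space \<nu> using admissibleD[OF a(1)] by simp
  interpret \<rho>: prob_space \<rho> using admissibleD[OF a(2)] by simp
  define k where "k = C * (sinh (sqrt 2 * R) * sqrt 2 / 2)"
  define c where "c = k * (- 4 * R ^ 3 / 3)"
  have k: "0 \<le> k" using C R(1) by (simp add: k_def)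
  have p: "(\<integral>y. W (x - y) \<partial>\<rho>) = k *
    ((\<bar>x - R\<bar> ^ 3 + \<bar>x + R\<bar> ^ 3) / 3 + R * ((x - R) * \<bar>x - R\<bar> - (x + R) * \<bar>x + R\<bar>))" for x
    unfolding \<rho>_def k_def by (rule potential_rho1[OF less_imp_le[OF C] R])
  have ge: "c \<le> (\<integral>y. W (x - y) \<partial>\<rho>)" for x
    unfolding p c_def using k potential_polynomial(2)[OF R(1)] by (rule mult_left_mono[rotated])
  have eq: "(\<integral>y. W (x - y) \<partial>\<rho>) = c" if "\<bar>x\<bar> \<le> R" for x
    unfolding p c_def potential_polynomial(1)[OF R(1) that] ..
  have "pair_energy (\<lambda>x y. W (x - y)) \<rho> \<rho> = (\<integral>x. c \<partial>\<rho>)"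
    unfolding pair_energy_def
  proof (rule integral_cong_AE)
    show "AE x in \<rho>. (\<integral>y. W (x - y) \<partial>\<rho>) = c"
      using AE_rho1_measure[where C = C and R = R] unfolding \<rho>_def[symmetric] by eventually_elim (rule eq)
  qed (use cubic_growth_outer[OF a(2) a(2) cubic_growth_W] in auto)
  moreover have "(\<integral>x. c \<partial>\<nu>) \<le> pair_energy (\<lambda>x y. W (x - y)) \<nu> \<rho>"
    unfolding pair_energy_def
    by (intro integral_mono cubic_growth_outer[OF a cubic_growth_W] ge) auto
  moreover have "energy_dist (\<lambda>x y. W (x - y)) \<nu> \<rho> \<ge> 2 * energy_dist step_kernel \<nu> \<rho>"
    by (rule energy_dist_W[OF \<nu> \<rho>])
  \<comment> \<open>The self-energy of \<open>\<rho>\<close> is \<open>c\<close> and the cross term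
    is at least \<open>c\<close>, both measures having mass one; solving \<open>energy_dist\<close>
    for the energy of \<open>\<nu>\<close> gives the bound.\<close>
  ultimately show ?thesis
    by (simp add: energy_dist_def[of "\<lambda>x y. W (x - y)"] \<nu>.prob_space \<rho>.prob_space)
qed

section \<open>Finite and infinite energy\<close>

text \<open>Boundedness below keeps the negative parts finite, so that no difference of infinities
  arises in \<open>ext_integral\<close>. The minimum of \<open>W\<close> is at
  \<open>\<bar>x\<bar> = 1\<close>, whence the double root there.\<close>

lemma minus_W_le: "- W x \<le> 1"
proof -
  have "0 \<le> (\<bar>x\<bar> - 1)\<^sup>2 * (\<bar>x\<bar> + 2)" by simp
  then show ?thesis
    by (simp add: W_def power2_eq_square power3_eq_cube algebra_simps)
qed

lemma W_measurable [measurable]: "W \<in> borel_measurable borel"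
  unfolding W_def[abs_def] by measurable

lemma interaction_energy_admissible:
  assumes "admissible \<mu>"
  shows "interaction_energy W \<mu> = ereal (pair_energy (\<lambda>x y. W (x - y)) \<mu> \<mu> / 2)"
  unfolding interaction_energy_def pair_energy_def
  by (simp add: ext_integral_eq_integral[OF cubic_growth_inner[OF assms cubic_growth_W]]
      ext_integral_eq_integral[OF cubic_growth_outer[OF assms assms cubic_growth_W]])

lemma add_cube_le:
  fixes a b :: real
  assumes "0 \<le> a" "0 \<le> b"
  shows "(a + b) ^ 3 \<le> 4 * (a ^ 3 + b ^ 3)"
proof -
  have "0 \<le> 3 * ((a + b) * (a - b)\<^sup>2)" using assms by simp
  then show ?thesis by (simp add: power3_eq_cube power2_eq_square algebra_simps)
qed

text \<open>Integrability of \<open>W (x - y)\<close> in \<open>y\<close> for a single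
  \<open>x\<close> thereby forces a finite third moment. The constants are four times those in
  \<open>b ^ 3 \<le> 6 * W (x - y) + 16\<close>.\<close>

lemma abs_cube_le_W: "\<bar>y\<bar> ^ 3 \<le> 64 + 4 * \<bar>x\<bar> ^ 3 + 24 * W (x - y)"
proof -
  define a b where "a = \<bar>x\<bar>" and "b = \<bar>x - y\<bar>"
  have ab: "0 \<le> a" "0 \<le> b" and y: "\<bar>y\<bar> \<le> a + b" by (auto simp: a_def b_def)
  have "\<bar>y\<bar> ^ 3 \<le> (a + b) ^ 3" using y by (intro power_mono) auto
  also have "\<dots> \<le> 4 * (a ^ 3 + b ^ 3)"
    using ab by (rule add_cube_le)
  finally have "\<bar>y\<bar> ^ 3 \<le> 4 * a ^ 3 + 4 * b ^ 3" by simp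
  moreover have "b ^ 3 \<le> 6 * W (x - y) + 16"
  proof -
    \<comment> \<open>The product is \<open>b ^ 3 - 12 * b + 16\<close>; half of it absorbs the
      linear term of \<open>6 * W (x - y)\<close>.\<close>
    have "0 \<le> (b - 2)\<^sup>2 * (b + 4)" "0 \<le> b ^ 3" using ab by simp_all
    then show ?thesis
      unfolding W_def b_def[symmetric] by (simp add: power3_eq_cube power2_eq_square algebra_simps)
  qed
  ultimately show ?thesis unfolding a_def[symmetric] by simp
qed

text \<open>The inner integral is already infinite for every \<open>x\<close>: its negative part is
  at most one, and a finite positive part would give a third moment by
  \<open>abs_cube_le_W\<close>.\<close>

lemma interaction_energy_not_admissible:
  assumes "\<mu> \<in> prob_measures" "\<not> admissible \<mu>"
  shows "interaction_energy W \<mu> = \<infinity>"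
proof -
  interpret prob_space \<mu> using assms by (simp add: prob_measures_def)
  have [measurable_cong]: "sets \<mu> = sets borel" using assms by (simp add: prob_measures_def)
  have inner: "ext_integral \<mu> (\<lambda>y. ereal (W (x - y))) = \<infinity>" for x
  proof -
    have neg: "(\<integral>\<^sup>+y. ennreal (- W (x - y)) \<partial>\<mu>) < \<infinity>"
    proof -
      have "(\<integral>\<^sup>+y. ennreal (- W (x - y)) \<partial>\<mu>) \<le> (\<integral>\<^sup>+y. 1 \<partial>\<mu>)"
        using minus_W_le by (intro nn_integral_mono) (simp add: ennreal_le_1)
      then show ?thesis by (auto simp: emeasure_space_1 intro: le_less_trans)
    qed
    have pos: "(\<integral>\<^sup>+y. ennreal (W (x - y)) \<partial>\<mu>) = \<infinity>"
    proof (rule ccontr)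
      assume "(\<integral>\<^sup>+y. ennreal (W (x - y)) \<partial>\<mu>) \<noteq> \<infinity>"
      with neg have "integrable \<mu> (\<lambda>y. W (x - y))"
        by (auto simp: real_integrable_def)
      then have int: "integrable \<mu> (\<lambda>y. 64 + 4 * \<bar>x\<bar> ^ 3 + 24 * W (x - y))" by simp
      have "norm (\<bar>y\<bar> ^ 3) \<le> norm (64 + 4 * \<bar>x\<bar> ^ 3 + 24 * W (x - y))" for y
      proof -
        have "norm (\<bar>y\<bar> ^ 3) = \<bar>y\<bar> ^ 3" by simp
        also have "\<dots> \<le> 64 + 4 * \<bar>x\<bar> ^ 3 + 24 * W (x - y)" by (rule abs_cube_le_W)
        also have "\<dots> \<le> norm \<dots>" unfolding real_norm_def by (rule abs_ge_self)
        finally show ?thesis .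
      qed
      then have "integrable \<mu> (\<lambda>y. \<bar>y\<bar> ^ 3)"
        by (intro Bochner_Integration.integrable_bound[OF int] AE_I2) measurable
      with assms show False
        by (simp add: admissible_def prob_measures_def)
    qed
    have e: "e2ennreal (ereal t) = ennreal t" "e2ennreal (- ereal t) = ennreal (- t)" for t
      by (simp_all add: ennreal.abs_eq)
    obtain r where "0 \<le> r" "(\<integral>\<^sup>+y. ennreal (- W (x - y)) \<partial>\<mu>) = ennreal r"
      using neg by (cases "\<integral>\<^sup>+y. ennreal (- W (x - y)) \<partial>\<mu>") auto
    then show ?thesis
      unfolding ext_integral_def e pos by (simp add: enn2ereal_ennreal)
  qed
  have "ext_integral \<mu> (\<lambda>x. \<infinity>) = \<infinity>"
    by (simp add: ext_integral_def emeasure_space_1 e2ennreal_neg)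
  then show ?thesis by (simp add: interaction_energy_def inner)
qed

section \<open>Translation invariance and reduction to mean zero\<close>

lemma admissible_translate:
  assumes "admissible \<mu>"
  shows "admissible (translate a \<mu>)"
proof -
  interpret prob_space \<mu> using admissibleD[OF assms] by simp
  note [measurable_cong] = admissibleD(2)[OF assms]
  have "\<bar>x + a\<bar> ^ 3 \<le> 4 * \<bar>a\<bar> ^ 3 + 4 * \<bar>x\<bar> ^ 3" for x
  proof -
    have "\<bar>x + a\<bar> ^ 3 \<le> (\<bar>x\<bar> + \<bar>a\<bar>) ^ 3" by (intro power_mono) auto
    also have "\<dots> \<le> 4 * \<bar>a\<bar> ^ 3 + 4 * \<bar>x\<bar> ^ 3"
      using add_cube_le[of "\<bar>x\<bar>" "\<bar>a\<bar>"] by simp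
    finally show ?thesis .
  qed
  then have "integrable \<mu> (\<lambda>x. \<bar>x + a\<bar> ^ 3)"
    by (intro integrable_cubic_growth[OF assms]) auto
  then show ?thesis
    unfolding admissible_def translate_def
    by (auto intro!: prob_space_distr simp: integrable_distr_eq)
qed

lemma interaction_energy_translate:
  assumes "admissible \<mu>"
  shows "interaction_energy W (translate a \<mu>) = interaction_energy W \<mu>"
proof -
  interpret prob_space \<mu> using admissibleD[OF assms] by simp
  note [measurable_cong] = admissibleD(2)[OF assms]
  have inner: "(\<integral>y. W (x - y) \<partial>translate a \<mu>) = (\<integral>y. W (x - (y + a)) \<partial>\<mu>)" for x
    unfolding translate_def by (rule integral_distr) measurable
  have "(\<integral>x. \<integral>y. W (x - (y + a)) \<partial>\<mu> \<partial>translate a \<mu>) = (\<integral>x. \<integral>y. W (x + a - (y + a)) \<partial>\<mu> \<partial>\<mu>)"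
    unfolding translate_def by (rule integral_distr) measurable
  then have "pair_energy (\<lambda>x y. W (x - y)) (translate a \<mu>) (translate a \<mu>) = pair_energy (\<lambda>x y. W (x - y)) \<mu> \<mu>"
    unfolding pair_energy_def inner by simp
  then show ?thesis
    using interaction_energy_admissible[OF assms] interaction_energy_admissible[OF admissible_translate[OF assms]]
    by simp
qed

lemma translate_translate_minus:
  assumes "sets \<mu> = sets borel"
  shows "translate a (translate (- a) \<mu>) = \<mu>"
proof -
  note [measurable_cong] = assms
  have "translate a (translate (- a) \<mu>) = distr \<mu> borel ((\<lambda>x. x + a) \<circ> (\<lambda>x. x + - a))"
    unfolding translate_def by (rule distr_distr) measurable
  also have "(\<lambda>x. x + a) \<circ> (\<lambda>x. x + - a) = (\<lambda>x. x)" by (simp add: fun_eq_iff)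
  also have "distr \<mu> borel (\<lambda>x. x) = \<mu>" by (rule distr_id2) (rule assms[symmetric])
  finally show ?thesis .
qed

lemma centered_translate:
  assumes "admissible \<mu>"
  shows "centered (translate (- (\<integral>x. x \<partial>\<mu>)) \<mu>)"
proof -
  interpret prob_space \<mu> using admissibleD[OF assms] by simp
  note [measurable_cong] = admissibleD(2)[OF assms]
  have "(\<integral>x. x \<partial>translate (- m) \<mu>) = (\<integral>x. x + - m \<partial>\<mu>)" for m
    unfolding translate_def by (rule integral_distr) measurable
  then show ?thesis
    using integrable_moments(1)[OF assms] admissible_translate[OF assms]
    by (simp add: centered_def prob_space)
qed

section \<open>Characterization of the minimizers\<close>

lemma energy_minimizer_rho1:
  assumes C: "0 < C" and R: "0 < R" "sqrt 2 * R = coth (sqrt 2 * R)"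
    and 1: "emeasure (rho1_measure C R) UNIV = 1"
  shows "is_energy_minimizer W \<mu> \<longleftrightarrow> (\<exists>a. \<mu> = translate a (rho1_measure C R))"
proof
  let ?\<rho> = "rho1_measure C R"
  have \<rho>: "admissible ?\<rho>" using centered_rho1_measure[OF _ _ 1] C R(1) by (simp add: centered_def)
  \<comment> \<open>Minimality and the equality case are proved together, since both follow from
    \<open>pair_energy_W_ge\<close> applied to the recentred competitor.\<close>
  have min: "interaction_energy W ?\<rho> \<le> interaction_energy W \<nu>
      \<and> (interaction_energy W \<nu> \<le> interaction_energy W ?\<rho> \<longrightarrow> (\<exists>a. \<nu> = translate a ?\<rho>))"
    if \<nu>: "\<nu> \<in> prob_measures" for \<nu>
  proof (cases "admissible \<nu>")
    case True
    define m where "m = (\<integral>x. x \<partial>\<nu>)"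
    define \<nu>' where "\<nu>' = translate (- m) \<nu>"
    have c: "centered \<nu>'" and a: "admissible \<nu>'" and e: "interaction_energy W \<nu> = interaction_energy W \<nu>'"
      using centered_translate[OF True] interaction_energy_translate[OF True]
      by (simp_all add: \<nu>'_def m_def centered_def)
    note ge = pair_energy_W_ge[OF C R 1 c]
    \<comment> \<open>If \<open>\<nu>\<close> has no more energy than \<open>?\<rho>\<close>, the
      lower bound leaves no room for a positive step energy.\<close>
    have "\<nu> = translate m ?\<rho>" if "energy_dist step_kernel \<nu>' ?\<rho> \<le> 0"
      using energy_dist_step_eq_0[OF a \<rho> that] translate_translate_minus[of \<nu> m] admissibleD(2)[OF True]
      by (simp add: \<nu>'_def)
    then show ?thesis
      using ge energy_dist_step_nonneg[OF a \<rho>]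
      by (auto simp: e interaction_energy_admissible[OF a] interaction_energy_admissible[OF \<rho>])
  next
    case False
    then show ?thesis
      using interaction_energy_not_admissible[OF \<nu>] by (simp add: interaction_energy_admissible[OF \<rho>])
  qed
  have \<rho>': "?\<rho> \<in> prob_measures" using \<rho> by (simp add: admissible_def prob_measures_def)
  show "\<exists>a. \<mu> = translate a ?\<rho>" if "is_energy_minimizer W \<mu>"
    using that min[of \<mu>] \<rho>' by (auto simp: is_energy_minimizer_def)
  show "is_energy_minimizer W \<mu>" if "\<exists>a. \<mu> = translate a ?\<rho>"
  proof -
    from that obtain a where a: "\<mu> = translate a ?\<rho>" by blast
    show ?thesis
      using admissible_translate[OF \<rho>, of a] min
      by (auto simp: a is_energy_minimizer_def interaction_energy_translate[OF \<rho>] prob_measures_def admissible_def)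
  qed
qed

theorem mainTheorem3:
  shows "(\<exists>!R. R > 0 \<and> sqrt 2 * R = coth (sqrt 2 * R)) \<and>
    (\<forall>R. R > 0 \<and> sqrt 2 * R = coth (sqrt 2 * R) \<longrightarrow>
      (\<exists>!C. C > 0 \<and> emeasure (rho1_measure C R) UNIV = 1) \<and>
      (\<forall>C. C > 0 \<and> emeasure (rho1_measure C R) UNIV = 1 \<longrightarrow>
        (\<forall>\<rho>. is_energy_minimizer W \<rho> \<longleftrightarrow> (\<exists>a. \<rho> = translate a (rho1_measure C R)))))"
proof (intro conjI allI impI)
  show "\<exists>!R. R > 0 \<and> sqrt 2 * R = coth (sqrt 2 * R)" by (rule ex1_coth_fixpoint)
  fix R :: real assume R: "R > 0 \<and> sqrt 2 * R = coth (sqrt 2 * R)"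
  then have "0 < R" by blast
  let ?Z = "sqrt 2 * sinh (sqrt 2 * R)"
  have Z: "0 < ?Z" using \<open>0 < R\<close> by simp
  \<comment> \<open>The total mass is \<open>C * ?Z\<close>, linear in \<open>C\<close>, which pins
    down the normalizing constant.\<close>
  have iff: "C > 0 \<and> emeasure (rho1_measure C R) UNIV = 1 \<longleftrightarrow> C = 1 / ?Z" for C
  proof
    assume "C > 0 \<and> emeasure (rho1_measure C R) UNIV = 1"
    then have "C * ?Z = 1" using emeasure_rho1_measure[of C R] \<open>0 < R\<close> by (simp add: mult.assoc)
    then show "C = 1 / ?Z" using Z by (metis less_irrefl nonzero_eq_divide_eq)
  next
    assume C: "C = 1 / ?Z"
    then have "0 < C" "C * ?Z = 1" using Z by auto
    then show "C > 0 \<and> emeasure (rho1_measure C R) UNIV = 1"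
      using emeasure_rho1_measure[of C R] \<open>0 < R\<close> by (simp add: mult.assoc)
  qed
  show "\<exists>!C. C > 0 \<and> emeasure (rho1_measure C R) UNIV = 1" by (simp add: iff)
  fix C \<rho> assume "C > 0 \<and> emeasure (rho1_measure C R) UNIV = 1"
  then show "is_energy_minimizer W \<rho> \<longleftrightarrow> (\<exists>a. \<rho> = translate a (rho1_measure C R))"
    using R by (intro energy_minimizer_rho1) auto
qed

end
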